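(* Let $p,y\in[0,1]$, $a>0$, and let $n\ge2$ be an integer. Let $R\sim\operatorname{Poisson}(aC_n(y))$. Independently generate $R$ independent copies of the auxiliary Bernoulli variable $H_{n,y}$, and define $G_{n,y}\in\{0,1\}$ by setting $G_{n,y}=1$ if and only if all $R$ copies are zero. Then \[ \mathbb P(G_{n,y}=1)=e^{-ab_n(y)}\,e^{-a(p-y)^2}. \] Thus $G_{n,y}$ is a scaled likelihood coin for $\ell_y(p)=e^{-a(p-y)^2}$ (a Bernoulli variable whose success probability is a known constant in $(0,1]$ times $\ell_y(p)$), with known scaling factor $e^{-ab_n(y)}$.
   Context: For an integer $n\ge2$, $y\in[0,1]$ and $k=0,\ldots,n$ define \[ \beta_{k,n}(y)=y^2-\frac{2yk}{n}+\frac{k(k-1)}{n(n-1)},\qquad b_n(y):=-\min_{0\le k\le n}\beta_{k,n}(y)\ (\ge0), \] \[ c_{k,n}(y)=\beta_{k,n}(y)+b_n(y),\qquad C_n(y)=\max\Bigl\{1,\max_{0\le k\le n}c_{k,n}(y)\Bigr\}. \] The auxiliary variable $H_{n,y}$ is generated as follows: draw $K\sim\operatorname{Binomial}(n,p)$ (the sum of $n$ independent Bernoulli($p$) coins), and, conditional on $K=k$, draw $H_{n,y}\sim\operatorname{Bernoulli}\bigl(c_{k,n}(y)/C_n(y)\bigr)$. *)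

theory Defs
  imports "HOL-Probability.Probability"
begin

definition beta_coeff :: "nat \<Rightarrow> real \<Rightarrow> nat \<Rightarrow> real" where
  "beta_coeff n y k =
     y\<^sup>2 - 2 * y * real k / real n + real k * (real k - 1) / (real n * (real n - 1))"

definition b_shift :: "nat \<Rightarrow> real \<Rightarrow> real" where
  "b_shift n y = - Min (beta_coeff n y ` {0..n})"

definition c_coeff :: "nat \<Rightarrow> real \<Rightarrow> nat \<Rightarrow> real" where
  "c_coeff n y k = beta_coeff n y k + b_shift n y"

definition C_norm :: "nat \<Rightarrow> real \<Rightarrow> real" where
  "C_norm n y = max 1 (Max (c_coeff n y ` {0..n}))"

(* bernoulli_pmf clamps its argument to the unit interval and poisson_pmf is specified only for
   positive rates; these facts show that both are used within their proper range below. *)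

lemma C_norm_pos: "0 < C_norm n y"
  by (simp add: C_norm_def less_max_iff_disj)

lemma c_coeff_div_C_norm_in_unit:
  assumes "k \<le> n"
  shows "c_coeff n y k / C_norm n y \<in> {0..1}"
proof -
  have "Min (beta_coeff n y ` {0..n}) \<le> beta_coeff n y k"
    using assms by (intro Min_le) auto
  then have "0 \<le> c_coeff n y k"
    unfolding c_coeff_def b_shift_def by linarith
  moreover have "c_coeff n y k \<le> Max (c_coeff n y ` {0..n})"
    using assms by (intro Max_ge) auto
  then have "c_coeff n y k \<le> C_norm n y"
    by (simp add: C_norm_def)
  ultimately show ?thesis
    using C_norm_pos[of n y] by simp
qed

definition H_pmf :: "nat \<Rightarrow> real \<Rightarrow> real \<Rightarrow> bool pmf" where
  "H_pmf n y p =
     bind_pmf (binomial_pmf n p) (\<lambda>k. bernoulli_pmf (c_coeff n y k / C_norm n y))"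

text \<open>
  The values 1 and 0 of a coin are \<^term>\<open>True\<close> and \<^term>\<open>False\<close>; the list \<open>hs\<close> below
  consists of the \<open>R\<close> independent copies of the auxiliary coin.
\<close>

definition G_pmf :: "nat \<Rightarrow> real \<Rightarrow> real \<Rightarrow> real \<Rightarrow> bool pmf" where
  "G_pmf n y a p =
     bind_pmf (poisson_pmf (a * C_norm n y)) (\<lambda>R.
       map_pmf (\<lambda>hs. \<forall>h\<in>set hs. \<not> h) (replicate_pmf R (H_pmf n y p)))"

definition likelihood :: "real \<Rightarrow> real \<Rightarrow> real \<Rightarrow> real" where
  "likelihood a y p = exp (- a * (p - y)\<^sup>2)"

text \<open>
  A coin is a family of Boolean distributions indexed by the unknown parameter \<open>p\<close>. That the
  scaling factor \<open>s\<close> is known means that it does not depend on \<open>p\<close>.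
\<close>

definition scaled_likelihood_coin ::
    "real \<Rightarrow> (real \<Rightarrow> real) \<Rightarrow> (real \<Rightarrow> bool pmf) \<Rightarrow> bool" where
  "scaled_likelihood_coin s l G \<longleftrightarrow>
     s \<in> {0<..1} \<and> (\<forall>p\<in>{0..1}. pmf (G p) True = s * l p)"

end

theory Submission
  imports Defs
begin

text \<open>
  The coefficients \<^term>\<open>beta_coeff n y k\<close> are chosen so that, for a binomial count \<open>K\<close>, the
  statistic \<^term>\<open>beta_coeff n y K\<close> is an unbiased estimator of \<open>(p - y)\<^sup>2\<close>: since \<open>K / n\<close> and
  \<open>K (K - 1) / (n (n - 1))\<close> are unbiased for \<open>p\<close> and \<open>p\<^sup>2\<close>, its mean is \<open>y\<^sup>2 - 2 y p + p\<^sup>2\<close>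
  (lemma \<open>beta_coeff_unbiased\<close>). Shifting by \<^term>\<open>b_shift n y\<close> and dividing by
  \<^term>\<open>C_norm n y\<close> moves the estimator into the unit interval, so that it can be used as the
  success probability of a coin; that coin, \<^term>\<open>H_pmf n y p\<close>, then succeeds with probability
  \<open>h = ((p - y)\<^sup>2 + b_shift n y) / C_norm n y\<close> (lemma \<open>pmf_H_pmf_True\<close>).

  Exponentiation comes from the Poisson number of copies. All of \<open>R\<close> independent copies fail with
  probability \<open>(1 - h) ^ R\<close>, and averaging this over \<open>R\<close> evaluates the probability generating
  function of the Poisson distribution at \<open>1 - h\<close> (lemma \<open>poisson_pgf\<close>). The result is
  \<open>exp (- rate * h)\<close>, and the rate \<^term>\<open>a * C_norm n y\<close> cancels the normalisation in \<open>h\<close>.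

  The factor \<^term>\<open>exp (- a * b_shift n y)\<close> is at most 1 because \<^term>\<open>b_shift n y\<close> is
  nonnegative. This is again unbiasedness, now at \<open>p = y\<close>: there the mean is 0, and a minimum
  never exceeds a mean.
\<close>

lemma measure_replicate_pmf_lists:
  "measure (replicate_pmf r M) (lists A) = measure M A ^ r"
proof -
  have "emeasure (replicate_pmf r M) (lists A) = emeasure M A ^ r"
  proof (induction r)
    case 0
    show ?case by simp
  next
    case (Suc r)
    have cons: "emeasure (map_pmf ((#) x) (replicate_pmf r M)) (lists A) =
        emeasure (replicate_pmf r M) (lists A) * indicator A x" for x
    proof -
      have "(#) x -` lists A = (if x \<in> A then lists A else {})"
        by auto
      then show ?thesis
        by simp
    qed
    have "replicate_pmf (Suc r) M = bind_pmf M (\<lambda>x. map_pmf ((#) x) (replicate_pmf r M))"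
      by (simp add: map_pmf_def)
    then have "emeasure (replicate_pmf (Suc r) M) (lists A) =
        (\<integral>\<^sup>+x. emeasure (replicate_pmf r M) (lists A) * indicator A x \<partial>M)"
      by (simp only: emeasure_bind_pmf cons)
    also have "\<dots> = emeasure M A ^ Suc r"
      by (subst nn_integral_cmult_indicator) (simp_all add: Suc.IH mult.commute)
    finally show ?case .
  qed
  then have "ennreal (measure (replicate_pmf r M) (lists A)) = ennreal (measure M A ^ r)"
    by (simp add: measure_pmf.emeasure_eq_measure ennreal_power)
  then show ?thesis
    by simp
qed

lemma pmf_no_success_replicate_pmf:
  "pmf (map_pmf (\<lambda>hs. \<forall>h\<in>set hs. \<not> h) (replicate_pmf r H)) True = (1 - pmf H True) ^ r"
proof -
  have "(\<lambda>hs. \<forall>h\<in>set hs. \<not> h) -` {True} = lists {False}"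
    by (auto simp: lists_eq_set)
  moreover have "pmf H False = 1 - pmf H True"
    by (rule pmf_False_conv_True)
  ultimately show ?thesis
    by (simp add: pmf_map measure_replicate_pmf_lists measure_pmf_single)
qed

text \<open>
  The mean is the exponential series at \<open>rate * z\<close>, up to the factor \<open>exp (- rate)\<close>. For negative
  \<open>z\<close> the terms alternate, and it is absolute convergence that identifies integral and series.
\<close>

lemma poisson_pgf:
  fixes rate z :: real
  assumes "rate > 0"
  shows "measure_pmf.expectation (poisson_pmf rate) (\<lambda>r. z ^ r) = exp (rate * (z - 1))"
proof -
  define f where "f r = rate ^ r / fact r * exp (- rate) * z ^ r" for r :: nat
  have f: "f = (\<lambda>r. (rate * z) ^ r /\<^sub>R fact r * exp (- rate))"
    by (simp add: fun_eq_iff f_def power_mult_distrib field_simps)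
  have sums: "f sums (exp (rate * z) * exp (- rate))"
    unfolding f by (intro sums_mult2 exp_converges)
  have "integrable (count_space UNIV) f"
    using summable_norm_exp[of "rate * z"]
    by (simp add: integrable_count_space_nat_iff f abs_mult)
  then have "f sums (\<integral>r. f r \<partial>count_space UNIV)"
    by (rule sums_integral_count_space_nat)
  with sums have "(\<integral>r. f r \<partial>count_space UNIV) = exp (rate * z) * exp (- rate)"
    using sums_unique2 by blast
  moreover have "measure_pmf.expectation (poisson_pmf rate) (\<lambda>r. z ^ r) =
      (\<integral>r. f r \<partial>count_space UNIV)"
    unfolding measure_pmf_eq_density
    using assms by (subst integral_density) (simp_all add: f_def [abs_def])
  ultimately show ?thesis
    by (simp add: exp_add [symmetric] algebra_simps)
qed

lemma expectation_binomial_pmf_Bernstein: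
  fixes f :: "nat \<Rightarrow> real"
  assumes "p \<in> {0..1}"
  shows "measure_pmf.expectation (binomial_pmf n p) f = (\<Sum>k\<le>n. f k * Bernstein n k p)"
  using assms
  by (subst integral_measure_pmf_real[of "{..n}"])
    (auto simp: set_pmf_binomial_eq Bernstein_def split: if_splits)

text \<open>
  The coefficients are combinations of \<open>1\<close>, \<open>k\<close> and \<open>k (k - 1)\<close>, whose binomial means \<open>1\<close>,
  \<open>n p\<close> and \<open>n (n - 1) p\<^sup>2\<close> are polynomial identities in \<open>p\<close>.
\<close>

lemma beta_coeff_unbiased:
  assumes "n \<ge> 2"
  shows "(\<Sum>k\<le>n. beta_coeff n y k * Bernstein n k p) = (p - y)\<^sup>2"
proof -
  have "(\<Sum>k\<le>n. beta_coeff n y k * Bernstein n k p) =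
      (\<Sum>k\<le>n. y\<^sup>2 * Bernstein n k p - 2 * y / real n * (real k * Bernstein n k p)
        + 1 / (real n * (real n - 1)) * (real k * (real k - 1) * Bernstein n k p))"
    by (intro sum.cong refl) (simp add: beta_coeff_def left_diff_distrib distrib_right)
  also have "\<dots> = y\<^sup>2 - 2 * y / real n * (real n * p)
      + 1 / (real n * (real n - 1)) * (real n * (real n - 1) * p\<^sup>2)"
    by (simp only: sum.distrib sum_subtractf sum_distrib_left [symmetric]
        sum_Bernstein sum_k_Bernstein sum_kk_Bernstein mult_1_right)
  also have "\<dots> = (p - y)\<^sup>2"
    using assms by (simp add: power2_diff)
  finally show ?thesis .
qed

text \<open>
  The Bernstein weights at \<open>y\<close> itself average the coefficients to \<open>(y - y)\<^sup>2 = 0\<close>, so the smallest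
  coefficient is at most 0.
\<close>

lemma b_shift_nonneg:
  assumes "y \<in> {0..1}" and "n \<ge> 2"
  shows "b_shift n y \<ge> 0"
proof -
  have min: "- b_shift n y \<le> beta_coeff n y k" if "k \<le> n" for k
    unfolding b_shift_def minus_minus using that by (intro Min_le) auto
  have "- b_shift n y = (\<Sum>k\<le>n. - b_shift n y * Bernstein n k y)"
    by (simp only: sum_distrib_left [symmetric] sum_Bernstein mult_1_right)
  also have "\<dots> \<le> (\<Sum>k\<le>n. beta_coeff n y k * Bernstein n k y)"
    using assms min by (intro sum_mono mult_right_mono) (auto simp: Bernstein_nonneg)
  also have "\<dots> = 0"
    using assms by (simp add: beta_coeff_unbiased)
  finally show ?thesis
    by simp
qed

text \<open>
  The success probability is affine in the estimator, so unbiasedness passes through the shift and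
  the normalisation. This needs the Bernoulli parameter to lie in the unit interval for every \<open>k\<close>,
  where no clamping takes place.
\<close>

lemma pmf_H_pmf_True:
  assumes "p \<in> {0..1}" and "n \<ge> 2"
  shows "pmf (H_pmf n y p) True = ((p - y)\<^sup>2 + b_shift n y) / C_norm n y"
proof -
  have "pmf (H_pmf n y p) True =
      (\<Sum>k\<le>n. pmf (bernoulli_pmf (c_coeff n y k / C_norm n y)) True * Bernstein n k p)"
    using assms by (simp add: H_pmf_def pmf_bind expectation_binomial_pmf_Bernstein)
  also have "\<dots> = (\<Sum>k\<le>n. c_coeff n y k / C_norm n y * Bernstein n k p)"
    using c_coeff_div_C_norm_in_unit by (intro sum.cong refl) simp
  also have "\<dots> = (\<Sum>k\<le>n. beta_coeff n y k * Bernstein n k p + b_shift n y * Bernstein n k p)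
      / C_norm n y"
    by (simp add: c_coeff_def sum_divide_distrib algebra_simps)
  also have "\<dots> = ((p - y)\<^sup>2 + b_shift n y) / C_norm n y"
    using assms
    by (simp only: sum.distrib sum_distrib_left [symmetric] beta_coeff_unbiased sum_Bernstein
        mult_1_right)
  finally show ?thesis .
qed

lemma pmf_G_pmf_True:
  assumes "p \<in> {0..1}" and "a > 0" and "n \<ge> 2"
  shows "pmf (G_pmf n y a p) True = exp (- a * b_shift n y) * exp (- a * (p - y)\<^sup>2)"
proof -
  have "pmf (G_pmf n y a p) True = exp (a * C_norm n y * (1 - pmf (H_pmf n y p) True - 1))"
    using assms C_norm_pos[of n y]
    by (simp add: G_pmf_def pmf_bind pmf_no_success_replicate_pmf poisson_pgf)
  also have "a * C_norm n y * (1 - pmf (H_pmf n y p) True - 1) =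
      - a * b_shift n y + - a * (p - y)\<^sup>2"
    using assms C_norm_pos[of n y] by (simp add: pmf_H_pmf_True field_simps)
  finally show ?thesis
    by (simp only: exp_add)
qed

theorem theorem3p2:
  fixes p y a :: real and n :: nat
  assumes "p \<in> {0..1}" and "y \<in> {0..1}" and "a > 0" and "n \<ge> 2"
  shows "measure_pmf.prob (G_pmf n y a p) {g. g} =
           exp (- a * b_shift n y) * exp (- a * (p - y)\<^sup>2) \<and>
         scaled_likelihood_coin (exp (- a * b_shift n y)) (likelihood a y) (G_pmf n y a)"
proof
  have "{g. g} = {True}"
    by auto
  then show "measure_pmf.prob (G_pmf n y a p) {g. g} =
      exp (- a * b_shift n y) * exp (- a * (p - y)\<^sup>2)"
    using pmf_G_pmf_True[OF assms(1,3,4)] by (simp add: measure_pmf_single)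
  have "exp (- a * b_shift n y) \<in> {0<..1}"
    using assms b_shift_nonneg by simp
  then show "scaled_likelihood_coin (exp (- a * b_shift n y)) (likelihood a y) (G_pmf n y a)"
    using assms(3,4) pmf_G_pmf_True by (simp add: scaled_likelihood_coin_def likelihood_def)
qed

end
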